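(* Let $\mathbb{K} = \mathbb{R}$ or $\mathbb{C}$, let $1\le d\le n$ be integers, and let $\vec{r}\in\mathbb{Q}_+^n$ be admissible. Then every local minimum of the total frame energy $E_{\vec{r}} : \mathbb{K}^{d\times n}\to\mathbb{R}$ is a global minimum.
   Context: For $F = [f_1\ \cdots\ f_n]\in\mathbb{K}^{d\times n}$ with columns $f_i$ and $\vec{r}=(r_1,\dots,r_n)$ with positive entries, the total frame energy is $$E_{\vec{r}}(F) = \|FF^* - \mathbb{I}_d\|_{\mathrm{Fr}}^2 + \frac14 \sum_{i=1}^n\left(\frac{\|f_i\|^2}{r_i}-1\right)^2,$$ with $\|\cdot\|_{\mathrm{Fr}}$ the Frobenius norm and $F^*$ the (conjugate) transpose. $\vec{r}$ is admissible if $\sum_{i=1}^n r_i = d$ and $\sum_{i=1}^k r_{(i)} \le k$ for all $1\le k\le d-1$, where $r_{(1)}\ge\dots\ge r_{(n)}>0$ is the decreasing rearrangement of $(r_1,\dots,r_n)$. *)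

theory Defs
  imports "HOL-Analysis.Analysis" "HOL-Library.Multiset"
begin

text \<open>
  The space of \<open>d \<times> n\<close> matrices over \<open>\<K>\<close> is \<open>'k ^ 'n ^ 'd\<close> with \<open>d = CARD('d)\<close> and
  \<open>n = CARD('n)\<close>; the frame vectors are the columns. The conjugation \<open>c\<close> of the scalar
  field is a parameter, so that both cases share one definition: \<open>c = id\<close> for \<open>\<K> = \<real>\<close> and
  \<open>c = cnj\<close> for the complex numbers.
\<close>

definition conj_transpose :: "('k \<Rightarrow> 'k) \<Rightarrow> 'k ^ 'n ^ 'd \<Rightarrow> 'k ^ 'd ^ 'n" where
  "conj_transpose c F = (\<chi> j i. c (F $ i $ j))"

text \<open>
  The library norm on \<open>'k ^ 'n ^ 'd\<close> is the Euclidean norm of the Euclidean norms of the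
  rows, that is, the Frobenius norm (not the operator norm):
\<close>

lemma norm_matrix_eq_frobenius:
  fixes A :: "('k :: real_normed_vector) ^ 'n ^ 'd"
  shows "norm A = sqrt (\<Sum>i\<in>UNIV. \<Sum>j\<in>UNIV. (norm (A $ i $ j))\<^sup>2)"
  by (simp add: norm_vec_def L2_set_def sum_nonneg)

definition total_frame_energy ::
    "('k \<Rightarrow> 'k) \<Rightarrow> real ^ 'n \<Rightarrow> ('k :: real_normed_field) ^ 'n ^ 'd \<Rightarrow> real" where
  "total_frame_energy c r F =
     (norm (F ** conj_transpose c F - mat 1))\<^sup>2
     + 1 / 4 * (\<Sum>i\<in>UNIV. ((norm (column i F))\<^sup>2 / r $ i - 1)\<^sup>2)"

definition decreasing_rearrangement :: "real ^ 'n \<Rightarrow> real list" where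
  "decreasing_rearrangement r =
     rev (sorted_list_of_multiset (image_mset (\<lambda>i. r $ i) (mset_set UNIV)))"

lemma mset_decreasing_rearrangement:
  "mset (decreasing_rearrangement r) = image_mset (\<lambda>i. r $ i) (mset_set UNIV)"
  by (simp add: decreasing_rearrangement_def)

lemma length_decreasing_rearrangement:
  fixes r :: "real ^ 'n"
  shows "length (decreasing_rearrangement r) = CARD('n)"
  by (metis mset_decreasing_rearrangement size_mset size_image_mset size_mset_set)

lemma sorted_decreasing_rearrangement:
  "sorted_wrt (\<ge>) (decreasing_rearrangement r)"
  by (simp add: decreasing_rearrangement_def sorted_wrt_rev)

text \<open>Lists are indexed from 0, so \<open>decreasing_rearrangement r ! i\<close> is \<open>r\<^sub>(\<^sub>i\<^sub>+\<^sub>1\<^sub>)\<close>.\<close>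

definition admissible :: "nat \<Rightarrow> real ^ 'n \<Rightarrow> bool" where
  "admissible d r \<longleftrightarrow>
     (\<forall>i. r $ i > 0) \<and>
     (\<Sum>i\<in>UNIV. r $ i) = real d \<and>
     (\<forall>k\<in>{1..d - 1}. (\<Sum>i<k. decreasing_rearrangement r ! i) \<le> real k)"

definition is_local_min :: "('a :: topological_space \<Rightarrow> real) \<Rightarrow> 'a \<Rightarrow> bool" where
  "is_local_min f x \<longleftrightarrow> (\<forall>\<^sub>F y in nhds x. f x \<le> f y)"

definition is_global_min :: "('a \<Rightarrow> real) \<Rightarrow> 'a \<Rightarrow> bool" where
  "is_global_min f x \<longleftrightarrow> (\<forall>y. f x \<le> f y)"

end

theory Submission
  imports Defs
begin

text \<open>
  For admissible weights every local minimum in fact has energy zero; since the energy is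
  nonnegative, this is more than the claim. The argument is a second-variation argument in the
  spirit of Benedetto and Fickus.

  Let \<open>F\<close> be a local minimum with columns \<open>f\<^sub>i\<close>, let \<open>S = F F\<^sup>*\<close> be its frame operator and put
  \<open>n\<^sub>i = \<parallel>f\<^sub>i\<parallel>\<^sup>2\<close>. The first variation vanishes, which says that each \<open>f\<^sub>i\<close> is an eigenvector of
  \<open>S\<close> for a value \<open>l\<^sub>i\<close> tied to its length by \<open>n\<^sub>i = r\<^sub>i + 4 r\<^sub>i\<^sup>2 (1 - l\<^sub>i)\<close>
  (\<open>column_eigenvector_of_local_min\<close>). So a column is too short exactly when \<open>l\<^sub>i > 1\<close>. A zero
  column fits this formula with \<open>l\<^sub>i = 1 + 1 / (4 r\<^sub>i)\<close> and is not a special case.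

  The least eigenvalue \<open>m\<close> of \<open>S\<close> is at most 1: otherwise every \<open>l\<^sub>i\<close> exceeds 1, all columns are
  too short, and the trace of \<open>S\<close>, which is \<open>\<Sum> n\<^sub>i\<close>, is less than \<open>\<Sum> r\<^sub>i = d\<close>, although it is at
  least \<open>d m > d\<close>.

  Suppose now that some \<open>l\<^sub>j > 1\<close>. From \<open>S f\<^sub>j = \<Sum>\<^sub>i \<langle>f\<^sub>j, f\<^sub>i\<rangle> f\<^sub>i = l\<^sub>j f\<^sub>j\<close> one reads off a linear
  relation \<open>\<Sum> x\<^sub>i f\<^sub>i = 0\<close> with \<open>x = F\<^sup>* f\<^sub>j - l\<^sub>j e\<^sub>j\<close>. It is nontrivial because
  \<open>n\<^sub>j < r\<^sub>j \<le> 1 < l\<^sub>j\<close>, and it only involves columns with eigenvalue \<open>l\<^sub>j\<close>. Move every column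
  \<open>f\<^sub>i\<close> to \<open>f\<^sub>i + t (cj x\<^sub>i) e\<close>, where \<open>e\<close> is an eigenvector for \<open>m < l\<^sub>j\<close>. The relation cancels the
  terms of \<open>S\<close> linear in \<open>t\<close>, orthogonality of eigenspaces cancels those of the norms, and the
  coefficient of \<open>t\<^sup>2\<close> in the energy is a positive multiple of \<open>m - l\<^sub>j < 0\<close>, contrary to
  minimality (\<open>column_norm_eq_eigenvalue_of_local_min\<close>).

  Hence all \<open>l\<^sub>i \<le> 1\<close>, so \<open>n\<^sub>i \<ge> r\<^sub>i\<close>, and
  \<open>\<parallel>S - 1\<parallel>\<^sup>2 = \<Sum> l\<^sub>i n\<^sub>i - 2 \<Sum> n\<^sub>i + d \<le> d - \<Sum> n\<^sub>i \<le> 0\<close> forces \<open>S = 1\<close> and \<open>n\<^sub>i = r\<^sub>i\<close>.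
\<close>

section \<open>Local minima along lines\<close>

lemma first_coeff_zero_of_local_min:
  fixes a b c d :: real
  assumes "\<forall>\<^sub>F t in nhds 0. 0 \<le> a * t + b * t^2 + c * t^3 + d * t^4"
  shows "a = 0"
proof -
  let ?p = "\<lambda>t. a * t + b * t^2 + c * t^3 + d * t^4"
  obtain \<epsilon> where "\<epsilon> > 0" and pos: "\<And>t. \<bar>t\<bar> < \<epsilon> \<Longrightarrow> 0 \<le> ?p t"
    using assms unfolding eventually_nhds_metric dist_real_def by auto
  have "DERIV ?p 0 :> a"
    by (auto intro!: derivative_eq_intros)
  then show ?thesis
    using \<open>\<epsilon> > 0\<close> by (rule DERIV_local_min) (use pos in auto)
qed

lemma second_coeff_nonneg_of_local_min:
  fixes b d :: real
  assumes "\<forall>\<^sub>F t in nhds 0. 0 \<le> b * t^2 + d * t^4"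
  shows "0 \<le> b"
proof -
  have "\<forall>\<^sub>F t in at 0. 0 \<le> b * t^2 + d * t^4"
    using assms by (simp add: eventually_nhds_conv_at)
  then have "\<forall>\<^sub>F t in at 0. 0 \<le> b + d * t^2"
  proof (rule eventually_mp[rotated], intro eventually_mono[OF eventually_neq_at_within[of 0]] impI)
    fix t :: real
    assume "t \<noteq> 0" and "0 \<le> b * t^2 + d * t^4"
    then have "0 \<le> t^2 * (b + d * t^2)" by (simp add: algebra_simps power_numeral_reduce)
    with \<open>t \<noteq> 0\<close> show "0 \<le> b + d * t^2" by (simp add: zero_le_mult_iff)
  qed
  moreover have "((\<lambda>t. b + d * t^2) \<longlongrightarrow> b + d * 0^2) (at 0)"
    by (intro tendsto_intros)
  ultimately show ?thesis
    using tendsto_lowerbound[of "\<lambda>t. b + d * t^2" b "at 0" 0] by simp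
qed

lemma is_local_min_along_line:
  fixes F G :: "'a :: real_normed_vector"
  assumes "is_local_min f F"
  shows "\<forall>\<^sub>F t in nhds 0. f F \<le> f (F + t *\<^sub>R G)"
proof -
  have "((\<lambda>t. F + t *\<^sub>R G) \<longlongrightarrow> F + 0 *\<^sub>R G) (nhds 0)"
    by (intro tendsto_intros filterlim_ident)
  then show ?thesis
    using assms unfolding is_local_min_def
    using eventually_compose_filterlim[of "\<lambda>y. f F \<le> f y" "nhds F"] by simp
qed

section \<open>Admissible weights\<close>

text \<open>
  For \<open>d \<ge> 2\<close> this is the condition for \<open>k = 1\<close>; for \<open>d = 1\<close> the range of \<open>k\<close> is empty and
  the bound comes from the total sum instead.
\<close>
lemma admissible_weight_le_one:
  fixes r :: "real ^ 'n"
  assumes "admissible d r"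
  shows "r $ i \<le> 1"
proof (cases "d \<le> 1")
  case True
  have "r $ i \<le> (\<Sum>i\<in>UNIV. r $ i)"
    by (rule member_le_sum) (use assms in \<open>auto simp: admissible_def intro: less_imp_le\<close>)
  also have "\<dots> \<le> 1" using assms True by (simp add: admissible_def)
  finally show ?thesis .
next
  case False
  let ?l = "decreasing_rearrangement r"
  have "r $ i \<in> set_mset (mset ?l)"
    unfolding mset_decreasing_rearrangement by simp
  then obtain k where "k < length ?l" "?l ! k = r $ i"
    by (auto simp: in_set_conv_nth)
  then have "r $ i \<le> ?l ! 0"
    using sorted_decreasing_rearrangement[of r]
    unfolding sorted_wrt_iff_nth_less by (metis not_gr_zero order_refl)
  also have "\<dots> \<le> 1"
    using assms False unfolding admissible_def
    by (auto dest!: bspec[where x = 1])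
  finally show ?thesis .
qed

section \<open>Matrices over a field with conjugation\<close>

lemma inner_matrix_columns:
  fixes A B :: "('k :: real_inner) ^ 'n ^ 'm"
  shows "inner A B = (\<Sum>j\<in>UNIV. inner (column j A) (column j B))"
  unfolding inner_vec_def column_def by (simp, rule sum.swap)

lemma column_matrix_mult:
  fixes A :: "('k :: semiring_1) ^ 'n ^ 'm"
  shows "column j (A ** B) = A *v column j B"
  by (simp add: vec_eq_iff column_def matrix_matrix_mult_def matrix_vector_mult_def)

lemma matrix_vector_mult_smult:
  fixes A :: "('k :: comm_semiring_1) ^ 'n ^ 'm"
  shows "A *v (k *s v) = k *s (A *v v)"
  by (simp add: vec_eq_iff matrix_vector_mult_def sum_distrib_left algebra_simps)

lemma matrix_vector_mult_axis:
  fixes A :: "('k :: comm_semiring_1) ^ 'n ^ 'm"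
  shows "A *v axis i k = k *s column i A"
  by (simp add: vec_eq_iff matrix_vector_mult_def axis_def column_def if_distrib mult.commute cong: if_cong)

text \<open>
  The real and the complex case are treated together. All inner products are the real ones,
  \<open>Re (x * cnj y)\<close> in the complex case, because the energy and its variations only involve
  these; the last axiom makes \<open>conj_transpose\<close> the adjoint for them.
\<close>
locale conjugation =
  fixes cj :: "'k :: {real_normed_field, euclidean_space} \<Rightarrow> 'k"
  assumes cj_add: "cj (x + y) = cj x + cj y"
    and cj_scaleR: "cj (t *\<^sub>R x) = t *\<^sub>R cj x"
    and cj_mult: "cj (x * y) = cj x * cj y"
    and cj_cj [simp]: "cj (cj x) = x"
    and inner_mult_cj: "inner (x * y) z = inner x (z * cj y)"
begin

lemma cj_zero [simp]: "cj 0 = 0"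
  using cj_scaleR[of 0 0] by simp

lemma cj_one [simp]: "cj 1 = 1"
  using cj_mult[of "cj 1" 1] by simp

lemma cj_diff: "cj (x - y) = cj x - cj y"
  using cj_add[of "x - y" y] by (simp add: algebra_simps)

lemma cj_sum: "cj (sum f A) = (\<Sum>a\<in>A. cj (f a))"
  by (induction A rule: infinite_finite_induct) (simp_all add: cj_add)

lemma inner_cj_cj [simp]: "inner (cj x) (cj y) = inner x y"
  using inner_mult_cj[of 1 "cj x" "cj y"] inner_mult_cj[of 1 y x]
  by (simp add: inner_commute mult.commute)

abbreviation adj :: "'k ^ 'n ^ 'm \<Rightarrow> 'k ^ 'm ^ 'n" where
  "adj \<equiv> conj_transpose cj"

lemma adj_diff: "adj (A - B) = adj A - adj B"
  and adj_adj [simp]: "adj (adj A) = A"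
  and adj_one [simp]: "adj (mat 1) = mat 1"
  by (simp_all add: conj_transpose_def vec_eq_iff cj_diff mat_def)

lemma adj_mult: "adj (A ** B) = adj B ** adj A"
  by (simp add: conj_transpose_def vec_eq_iff matrix_matrix_mult_def cj_sum cj_mult mult.commute)

lemma inner_adj_adj [simp]: "inner (adj A) (adj B) = inner A B"
  unfolding inner_vec_def conj_transpose_def by (simp, rule sum.swap)

lemma inner_mult_adj_right:
  fixes A :: "'k ^ 'n ^ 'm" and B :: "'k ^ 'l ^ 'n"
  shows "inner (A ** B) C = inner A (C ** adj B)"
proof -
  have "inner (A ** B) C = (\<Sum>i\<in>UNIV. \<Sum>j\<in>UNIV. \<Sum>k\<in>UNIV. inner (A $ i $ k * B $ k $ j) (C $ i $ j))"
    by (simp add: inner_vec_def matrix_matrix_mult_def inner_sum_left)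
  also have "\<dots> = (\<Sum>i\<in>UNIV. \<Sum>k\<in>UNIV. \<Sum>j\<in>UNIV. inner (A $ i $ k * B $ k $ j) (C $ i $ j))"
    by (intro sum.cong refl sum.swap)
  also have "\<dots> = inner A (C ** adj B)"
    by (simp add: inner_vec_def matrix_matrix_mult_def inner_sum_right inner_mult_cj conj_transpose_def)
  finally show ?thesis .
qed

lemma inner_matrix_vector_adj:
  fixes A :: "'k ^ 'n ^ 'm"
  shows "inner (A *v v) w = inner v (adj A *v w)"
proof -
  have "inner (A *v v) w = (\<Sum>i\<in>UNIV. \<Sum>k\<in>UNIV. inner (A $ i $ k * v $ k) (w $ i))"
    by (simp add: inner_vec_def matrix_vector_mult_def inner_sum_left)
  also have "\<dots> = (\<Sum>k\<in>UNIV. \<Sum>i\<in>UNIV. inner (v $ k * A $ i $ k) (w $ i))"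
    by (subst sum.swap) (simp add: mult.commute)
  also have "\<dots> = inner v (adj A *v w)"
    by (simp add: inner_vec_def matrix_vector_mult_def inner_sum_right inner_mult_cj
        conj_transpose_def mult.commute)
  finally show ?thesis .
qed

lemma norm_axis_one: "norm (axis a 1 :: 'k ^ 'd) = 1"
  by (simp add: norm_eq_sqrt_inner[of "axis a 1"] inner_axis_axis) (simp add: dot_square_norm)

lemma hermitian_eigenvectors_orthogonal:
  assumes herm: "adj A = A" and v: "A *v v = a *\<^sub>R v" and w: "A *v w = b *\<^sub>R w" and "a \<noteq> b"
  shows "inner v w = 0"
proof -
  have "a * inner v w = b * inner v w"
    using inner_matrix_vector_adj[of A v w] by (simp add: herm v w)
  with \<open>a \<noteq> b\<close> show ?thesis by simp
qed

lemma matrix_vector_mult_scaleR: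
  fixes A :: "'k ^ 'n ^ 'm"
  shows "A *v (t *\<^sub>R v) = t *\<^sub>R (A *v v)"
  by (simp add: vec_eq_iff matrix_vector_mult_def scaleR_sum_right)

text \<open>
  A minimiser \<open>e\<close> of the Rayleigh quotient on the compact unit sphere is an eigenvector: the
  form \<open>inner (A *v v) v - m * (norm v)\<^sup>2\<close> is nonnegative and vanishes at \<open>e\<close>, so its
  derivative there, \<open>2 * inner (A *v e - m *\<^sub>R e)\<close>, vanishes as well.
\<close>
lemma hermitian_least_eigenvector:
  fixes A :: "'k ^ 'd ^ 'd"
  assumes herm: "adj A = A"
  obtains e m where "norm e = 1" and "A *v e = m *\<^sub>R e"
    and "\<And>v. m * (norm v)\<^sup>2 \<le> inner (A *v v) v"
proof -
  let ?S = "sphere (0 :: 'k ^ 'd) 1"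
  let ?q = "\<lambda>v. inner (A *v v) v"
  have cont: "continuous_on ?S ?q"
    unfolding matrix_vector_mult_def by (intro continuous_intros)
  have "axis undefined 1 \<in> ?S"
    by (simp add: norm_axis_one)
  then obtain e where e: "e \<in> ?S" and min: "\<And>v. v \<in> ?S \<Longrightarrow> ?q e \<le> ?q v"
    using continuous_attains_inf[OF compact_sphere _ cont] by blast
  define m where "m = ?q e"
  have ray: "m * (norm v)\<^sup>2 \<le> ?q v" for v
  proof (cases "v = 0")
    case False
    then have "m \<le> ?q ((1 / norm v) *\<^sub>R v)"
      unfolding m_def by (intro min) simp
    also have "\<dots> = ?q v / (norm v)\<^sup>2"
      by (simp add: matrix_vector_mult_scaleR power2_eq_square)
    finally show ?thesis using False by (simp add: field_simps)
  qed simp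
  have eq: "A *v e = m *\<^sub>R e"
  proof -
    define w where "w = A *v e - m *\<^sub>R e"
    have "?q (e + t *\<^sub>R w) - m * (norm (e + t *\<^sub>R w))\<^sup>2
        = (2 * (norm w)\<^sup>2) * t + (?q w - m * (norm w)\<^sup>2) * t\<^sup>2 + 0 * t^3 + 0 * t^4" for t
    proof -
      have "inner (A *v w) e = inner (A *v e) w"
        using inner_matrix_vector_adj[of A w e] by (simp add: herm inner_commute)
      moreover have "inner e e = 1"
        using e by (simp add: dot_square_norm)
      moreover have "inner (A *v e) w - m * inner e w = inner w w"
        by (simp add: w_def inner_diff_left)
      ultimately show ?thesis
        unfolding power2_norm_eq_inner
        by (simp add: matrix_vector_right_distrib matrix_vector_mult_scaleR
            inner_add_left inner_add_right m_def[symmetric] inner_commute[of w e] power2_eq_square)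
          (simp add: algebra_simps)
    qed
    then have "\<forall>\<^sub>F t in nhds 0. 0 \<le> (2 * (norm w)\<^sup>2) * t + (?q w - m * (norm w)\<^sup>2) * t\<^sup>2 + 0 * t^3 + 0 * t^4"
      using ray by (metis (no_types, lifting) diff_ge_0_iff_ge eventuallyI)
    then have "2 * (norm w)\<^sup>2 = 0" by (rule first_coeff_zero_of_local_min)
    then show ?thesis by (simp add: w_def)
  qed
  show ?thesis using that[of e m] e eq ray by simp
qed

text \<open>Pairing with the identity is the (real part of the) trace.\<close>
lemma inner_one_eq_sum_axis:
  fixes A :: "'k ^ 'd ^ 'd"
  shows "inner A (mat 1) = (\<Sum>a\<in>UNIV. inner (A *v axis a 1) (axis a 1))"
proof -
  have "column a (mat 1) = (axis a 1 :: 'k ^ 'd)" for a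
    by (simp add: column_def mat_def axis_def)
  then show ?thesis
    by (simp add: inner_matrix_columns matrix_vector_mult_axis)
qed

lemma norm_one_matrix: "(norm (mat 1 :: 'k ^ 'd ^ 'd))\<^sup>2 = CARD('d)"
proof -
  have "inner (mat 1 :: 'k ^ 'd ^ 'd) (mat 1) = (\<Sum>a\<in>(UNIV :: 'd set). inner (axis a (1::'k)) (axis a 1))"
    by (simp add: inner_one_eq_sum_axis)
  also have "\<dots> = CARD('d)"
    by (simp add: dot_square_norm norm_axis_one)
  finally show ?thesis by (simp add: power2_norm_eq_inner)
qed

section \<open>Variation of the energy\<close>

lemma energy_along_line:
  fixes F G :: "'k ^ 'n ^ 'd" and r :: "real ^ 'n"
  defines "M \<equiv> F ** adj F - mat 1"
    and "P \<equiv> F ** adj G + G ** adj F"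
    and "Q \<equiv> G ** adj G"
    and "s \<equiv> \<lambda>i. (norm (column i F))\<^sup>2 / r $ i - 1"
    and "p \<equiv> \<lambda>i. inner (column i F) (column i G) / r $ i"
    and "q \<equiv> \<lambda>i. (norm (column i G))\<^sup>2 / r $ i"
  shows "total_frame_energy cj r (F + t *\<^sub>R G) - total_frame_energy cj r F
    = (2 * inner M P + (\<Sum>i\<in>UNIV. s i * p i)) * t
      + ((norm P)\<^sup>2 + 2 * inner M Q + (\<Sum>i\<in>UNIV. s i * q i / 2 + (p i)\<^sup>2)) * t^2
      + (2 * inner P Q + (\<Sum>i\<in>UNIV. p i * q i)) * t^3
      + ((norm Q)\<^sup>2 + (\<Sum>i\<in>UNIV. (q i)\<^sup>2 / 4)) * t^4"
proof -
  have mat: "(F + t *\<^sub>R G) ** adj (F + t *\<^sub>R G) - mat 1 = M + t *\<^sub>R P + t\<^sup>2 *\<^sub>R Q"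
    by (simp add: M_def P_def Q_def vec_eq_iff matrix_matrix_mult_def conj_transpose_def
        cj_add cj_scaleR sum.distrib scaleR_sum_right algebra_simps power2_eq_square)
  have col: "(norm (column i (F + t *\<^sub>R G)))\<^sup>2 / r $ i - 1 = s i + 2 * t * p i + t\<^sup>2 * q i" for i
  proof -
    have "column i (F + t *\<^sub>R G) = column i F + t *\<^sub>R column i G"
      by (simp add: column_def vec_eq_iff)
    then show ?thesis
      unfolding s_def p_def q_def power2_norm_eq_inner
      by (simp add: inner_add_left inner_add_right
          inner_commute[of "column i G" "column i F"] add_divide_distrib power2_eq_square algebra_simps)
  qed
  have 1: "(norm (M + t *\<^sub>R P + t\<^sup>2 *\<^sub>R Q))\<^sup>2 = (norm M)\<^sup>2 + 2 * inner M P * t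
      + ((norm P)\<^sup>2 + 2 * inner M Q) * t^2 + 2 * inner P Q * t^3 + (norm Q)\<^sup>2 * t^4"
    by (simp add: power2_norm_eq_inner inner_add_left inner_add_right inner_commute[of P M]
        inner_commute[of Q M] inner_commute[of Q P])
      (simp add: algebra_simps power_numeral_reduce)
  have 2: "(\<Sum>i\<in>UNIV. (s i + 2 * t * p i + t\<^sup>2 * q i)\<^sup>2) / 4 = (\<Sum>i\<in>UNIV. (s i)\<^sup>2) / 4
      + (\<Sum>i\<in>UNIV. s i * p i) * t + (\<Sum>i\<in>UNIV. s i * q i / 2 + (p i)\<^sup>2) * t^2
      + (\<Sum>i\<in>UNIV. p i * q i) * t^3 + (\<Sum>i\<in>UNIV. (q i)\<^sup>2 / 4) * t^4"
    unfolding sum_divide_distrib sum_distrib_right sum.distrib[symmetric]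
    by (intro sum.cong refl) (simp add: field_simps power_numeral_reduce)
  have E: "total_frame_energy cj r F = (norm M)\<^sup>2 + (\<Sum>i\<in>UNIV. (s i)\<^sup>2) / 4"
    by (simp add: total_frame_energy_def M_def s_def)
  have Et: "total_frame_energy cj r (F + t *\<^sub>R G) = (norm (M + t *\<^sub>R P + t\<^sup>2 *\<^sub>R Q))\<^sup>2
      + (\<Sum>i\<in>UNIV. (s i + 2 * t * p i + t\<^sup>2 * q i)\<^sup>2) / 4"
    unfolding total_frame_energy_def mat col by simp
  show ?thesis
    unfolding E Et 1 2 by (simp add: algebra_simps)
qed

text \<open>
  Moving only column \<open>i\<close>, in the direction \<open>w\<close>, changes the energy to first order by the inner
  product of \<open>w\<close> with \<open>4 (S - 1) f\<^sub>i + (n\<^sub>i / r\<^sub>i - 1) / r\<^sub>i f\<^sub>i\<close>. Taking \<open>w\<close> to be that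
  gradient shows that it is zero.
\<close>
lemma column_eigenvector_of_local_min:
  fixes F :: "'k ^ 'n ^ 'd" and r :: "real ^ 'n"
  assumes min: "is_local_min (total_frame_energy cj r) F"
  shows "(F ** adj F) *v column i F
    = (1 - ((norm (column i F))\<^sup>2 / r $ i - 1) / (4 * r $ i)) *\<^sub>R column i F"
proof -
  define M where "M = F ** adj F - mat 1"
  define s where "s i = (norm (column i F))\<^sup>2 / r $ i - 1" for i
  define w where "w = 4 *\<^sub>R (M *v column i F) + (s i / r $ i) *\<^sub>R column i F"
  define G :: "'k ^ 'n ^ 'd" where "G = (\<chi> a k. if k = i then w $ a else 0)"
  have col_G: "column k G = (if k = i then w else 0)" for k
    by (simp add: column_def G_def vec_eq_iff)
  have herm: "adj M = M"
    by (simp add: M_def adj_diff adj_mult)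
  have "inner M (F ** adj G + G ** adj F) = 2 * inner M (G ** adj F)"
    using inner_adj_adj[of M "F ** adj G"] by (simp add: herm adj_mult inner_add_right)
  also have "inner M (G ** adj F) = inner (M ** F) G"
    using inner_mult_adj_right[of M F G] inner_mult_adj_right[of G "adj F" M]
    by (simp add: inner_commute)
  also have "\<dots> = inner (M *v column i F) w"
    by (simp add: inner_matrix_columns column_matrix_mult col_G if_distrib cong: if_cong)
  finally have MP: "inner M (F ** adj G + G ** adj F) = 2 * inner (M *v column i F) w" .
  have sp: "(\<Sum>k\<in>UNIV. s k * (inner (column k F) (column k G) / r $ k))
      = (s i / r $ i) * inner (column i F) w"
  proof -
    have "(\<Sum>k\<in>UNIV. s k * (inner (column k F) (column k G) / r $ k))
        = (\<Sum>k\<in>UNIV. if k = i then s i * (inner (column i F) w / r $ i) else 0)"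
      by (intro sum.cong) (simp_all add: col_G)
    then show ?thesis by simp
  qed
  have "\<forall>\<^sub>F t in nhds 0. 0 \<le> total_frame_energy cj r (F + t *\<^sub>R G) - total_frame_energy cj r F"
    using is_local_min_along_line[OF min, of G] by simp
  then have "2 * inner M (F ** adj G + G ** adj F)
      + (\<Sum>k\<in>UNIV. s k * (inner (column k F) (column k G) / r $ k)) = 0"
    unfolding energy_along_line M_def s_def by (rule first_coeff_zero_of_local_min)
  then have "inner w w = 0"
    unfolding MP sp by (simp add: w_def inner_add_left)
  then have "4 *\<^sub>R (M *v column i F) = - (s i / r $ i) *\<^sub>R column i F"
    by (simp add: w_def eq_neg_iff_add_eq_0)
  then have "(1/4) *\<^sub>R (4 *\<^sub>R (M *v column i F)) = (1/4) *\<^sub>R (- (s i / r $ i) *\<^sub>R column i F)"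
    by simp
  then have "M *v column i F = - (s i / (4 * r $ i)) *\<^sub>R column i F"
    by simp
  then have "(F ** adj F) *v column i F = column i F - (s i / (4 * r $ i)) *\<^sub>R column i F"
    by (simp add: M_def matrix_vector_mult_diff_rdistrib algebra_simps)
  then show ?thesis
    by (simp add: s_def scaleR_left_diff_distrib)
qed

text \<open>
  Real orthogonality to all scalar multiples of a column amounts to orthogonality over the
  field of scalars, which is what the entries of \<open>adj F *v v\<close> measure.
\<close>
lemma adj_mult_column_eq_zero:
  fixes F :: "'k ^ 'n ^ 'd"
  assumes orth: "\<And>k. inner (k *s column i F) v = 0"
  shows "(adj F *v v) $ i = 0"
proof -
  define k where "k = (adj F *v v) $ i"
  have "inner k k = inner (axis i k) (adj F *v v)"
    by (simp add: inner_axis' k_def)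
  also have "\<dots> = inner (F *v axis i k) v"
    by (simp add: inner_matrix_vector_adj)
  finally show ?thesis
    using orth by (simp add: k_def matrix_vector_mult_axis)
qed

lemma inner_matrix_eigencolumns:
  fixes A :: "'k ^ 'd ^ 'd" and B :: "'k ^ 'n ^ 'd"
  assumes "\<And>i. A *v column i B = l i *\<^sub>R column i B"
  shows "inner (A ** B) B = (\<Sum>i\<in>UNIV. l i * (norm (column i B))\<^sup>2)"
  by (simp add: inner_matrix_columns column_matrix_mult assms power2_norm_eq_inner)

text \<open>
  The vector \<open>x\<close> below is a linear relation between the columns, with \<open>j\<close>-th entry
  \<open>(norm (column j F))\<^sup>2 - l j\<close>. If this entry is not zero, adding multiples of \<open>e\<close> to the
  columns according to \<open>x\<close> lowers the energy: the terms linear in \<open>t\<close> cancel, and in the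
  coefficient of \<open>t\<^sup>2\<close> the frame operator contributes \<open>2 * (m - 1)\<close> and the column norms
  contribute \<open>2 * (1 - l j)\<close>, each times \<open>(norm G)\<^sup>2\<close>.
\<close>
lemma column_norm_eq_eigenvalue_of_local_min:
  fixes F :: "'k ^ 'n ^ 'd" and r :: "real ^ 'n"
  assumes min: "is_local_min (total_frame_energy cj r) F"
    and frame_eig: "\<And>i. (F ** adj F) *v column i F = l i *\<^sub>R column i F"
    and l: "\<And>i. ((norm (column i F))\<^sup>2 / r $ i - 1) / r $ i = 4 * (1 - l i)"
    and e: "norm e = 1" "(F ** adj F) *v e = m *\<^sub>R e"
    and less: "m < l j"
  shows "(norm (column j F))\<^sup>2 = l j"
proof (rule ccontr)
  assume ne: "(norm (column j F))\<^sup>2 \<noteq> l j"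
  define S where "S = F ** adj F"
  define M where "M = S - mat 1"
  have herm: "adj S = S"
    by (simp add: S_def adj_mult)
  have eig: "S *v column i F = l i *\<^sub>R column i F" for i
    using frame_eig by (simp add: S_def)
  have eig_smult: "S *v (k *s v) = a *\<^sub>R (k *s v)" if "S *v v = a *\<^sub>R v" for k v a
    using that by (simp add: matrix_vector_mult_smult vec_eq_iff)
  define x :: "'k ^ 'n" where "x = adj F *v column j F - l j *\<^sub>R axis j 1"
  have x_zero: "x $ i = 0" if "l i \<noteq> l j" for i
  proof -
    have "(adj F *v column j F) $ i = 0"
      by (intro adj_mult_column_eq_zero
          hermitian_eigenvectors_orthogonal[OF herm eig_smult[OF eig] eig that])
    then show ?thesis
      using that by (auto simp: x_def axis_def)
  qed
  have x_ne: "x $ j \<noteq> 0"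
  proof
    assume "x $ j = 0"
    have "inner (x $ j) 1 = inner (adj F *v column j F) (axis j 1) - l j * inner (axis j (1::'k)) (axis j 1)"
      by (simp add: x_def inner_diff_left inner_axis)
    also have "inner (adj F *v column j F) (axis j 1) = inner (column j F) (F *v axis j 1)"
      by (simp add: inner_matrix_vector_adj)
    also have "\<dots> = (norm (column j F))\<^sup>2"
      by (simp add: matrix_vector_mult_axis power2_norm_eq_inner)
    finally show False
      using ne \<open>x $ j = 0\<close> by (simp add: dot_square_norm norm_axis_one)
  qed
  have Fx: "F *v x = 0"
  proof -
    have "F *v x = S *v column j F - l j *\<^sub>R (F *v axis j 1)"
      by (simp add: x_def S_def matrix_vector_mult_diff_distrib matrix_vector_mult_scaleR
          matrix_vector_mul_assoc)
    then show ?thesis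
      by (simp add: eig matrix_vector_mult_axis)
  qed
  \<comment> \<open>The conjugate is needed because \<open>G\<close> enters the frame operator as \<open>F ** adj G\<close>, which has to
    reduce to \<open>F *v x = 0\<close>.\<close>
  define G :: "'k ^ 'n ^ 'd" where "G = (\<chi> a i. cj (x $ i) * e $ a)"
  have col_G: "column i G = cj (x $ i) *s e" for i
    by (simp add: column_def G_def vec_eq_iff)
  have FG: "F ** adj G = 0"
  proof -
    have "(F ** adj G) $ a $ b = (F *v x) $ a * cj (e $ b)" for a b
      by (simp add: matrix_matrix_mult_def matrix_vector_mult_def conj_transpose_def G_def cj_mult
          sum_distrib_right mult.assoc)
    then show ?thesis by (simp add: Fx vec_eq_iff)
  qed
  have GF: "G ** adj F = 0"
    using arg_cong[OF FG, of adj] by (simp add: adj_mult) (simp add: conj_transpose_def vec_eq_iff)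
  have eig_G: "S *v column i G = m *\<^sub>R column i G" for i
    unfolding col_G by (rule eig_smult) (simp add: S_def e(2))
  have p: "inner (column i F) (column i G) = 0" for i
  proof (cases "l i = l j")
    case True
    then show ?thesis
      using hermitian_eigenvectors_orthogonal[OF herm eig eig_G] less by simp
  next
    case False
    then show ?thesis by (simp add: col_G x_zero)
  qed
  have MQ: "inner M (G ** adj G) = (m - 1) * (norm G)\<^sup>2"
  proof -
    have "inner M (G ** adj G) = inner (M ** G) G"
      using inner_mult_adj_right[of M G G] by simp
    also have "\<dots> = (\<Sum>i\<in>UNIV. (m - 1) * (norm (column i G))\<^sup>2)"
      by (rule inner_matrix_eigencolumns)
        (simp add: M_def matrix_vector_mult_diff_rdistrib eig_G algebra_simps)
    finally show ?thesis
      by (simp add: power2_norm_eq_inner inner_matrix_columns[of G] sum_distrib_left)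
  qed
  have sq: "(\<Sum>i\<in>UNIV. ((norm (column i F))\<^sup>2 / r $ i - 1) * ((norm (column i G))\<^sup>2 / r $ i) / 2)
      = 2 * (1 - l j) * (norm G)\<^sup>2"
  proof -
    have "((norm (column i F))\<^sup>2 / r $ i - 1) * ((norm (column i G))\<^sup>2 / r $ i) / 2
        = 2 * (1 - l j) * (norm (column i G))\<^sup>2" for i
    proof (cases "l i = l j")
      case True
      have "((norm (column i F))\<^sup>2 / r $ i - 1) * ((norm (column i G))\<^sup>2 / r $ i) / 2
          = ((norm (column i F))\<^sup>2 / r $ i - 1) / r $ i * (norm (column i G))\<^sup>2 / 2"
        by simp
      then show ?thesis unfolding l True by simp
    next
      case False
      then show ?thesis by (simp add: col_G x_zero)
    qed
    then show ?thesis
      by (simp add: power2_norm_eq_inner inner_matrix_columns[of G] sum_distrib_left)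
  qed
  have energy: "total_frame_energy cj r (F + t *\<^sub>R G) - total_frame_energy cj r F
      = (2 * (m - l j) * (norm G)\<^sup>2) * t^2
        + ((norm (G ** adj G))\<^sup>2 + (\<Sum>i\<in>UNIV. ((norm (column i G))\<^sup>2 / r $ i)\<^sup>2 / 4)) * t^4" for t
    unfolding energy_along_line FG GF p sum.distrib sq MQ[unfolded M_def S_def]
    by (simp add: algebra_simps)
  have "\<forall>\<^sub>F t in nhds 0. 0 \<le> (2 * (m - l j) * (norm G)\<^sup>2) * t^2
      + ((norm (G ** adj G))\<^sup>2 + (\<Sum>i\<in>UNIV. ((norm (column i G))\<^sup>2 / r $ i)\<^sup>2 / 4)) * t^4"
    unfolding energy[symmetric] using is_local_min_along_line[OF min, of G] by simp
  then have "0 \<le> 2 * (m - l j) * (norm G)\<^sup>2"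
    by (rule second_coeff_nonneg_of_local_min)
  moreover have "G \<noteq> 0"
  proof
    assume "G = 0"
    then have "cj (x $ j) *s e = 0"
      using col_G[of j] by (simp add: column_def vec_eq_iff)
    moreover have "cj (x $ j) \<noteq> 0"
      using x_ne cj_cj[of "x $ j"] by (metis cj_zero)
    ultimately show False
      using e(1) by (simp add: vector_mul_eq_0)
  qed
  ultimately show False
    using less by (simp add: zero_le_mult_iff)
qed

section \<open>Local minima have energy zero\<close>

lemma frame_energy_zero_of_local_min:
  fixes F :: "'k ^ 'n ^ 'd" and r :: "real ^ 'n"
  assumes min: "is_local_min (total_frame_energy cj r) F" and pos: "\<And>i. r $ i > 0"
    and le_one: "\<And>i. r $ i \<le> 1" and sum_r: "(\<Sum>i\<in>UNIV. r $ i) = CARD('d)"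
  shows "total_frame_energy cj r F = 0"
proof -
  define S where "S = F ** adj F"
  define n where "n i = (norm (column i F))\<^sup>2" for i
  define l where "l i = 1 - (n i / r $ i - 1) / (4 * r $ i)" for i
  have eig: "S *v column i F = l i *\<^sub>R column i F" for i
    using column_eigenvector_of_local_min[OF min] by (simp add: S_def n_def l_def)
  have n_eq: "n i = r $ i + 4 * (r $ i)\<^sup>2 * (1 - l i)" for i
    using pos[of i] by (simp add: l_def field_simps power2_eq_square)
  have l_eq: "((norm (column i F))\<^sup>2 / r $ i - 1) / r $ i = 4 * (1 - l i)" for i
    using pos[of i] by (simp add: l_def n_def field_simps)
  have trace: "inner S (mat 1) = (\<Sum>i\<in>UNIV. n i)"
    using inner_mult_adj_right[of F "adj F" "mat 1"]
    by (simp add: S_def n_def inner_matrix_columns[of F] power2_norm_eq_inner)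
  obtain e m where e: "norm e = 1" "S *v e = m *\<^sub>R e"
    and ray: "\<And>v. m * (norm v)\<^sup>2 \<le> inner (S *v v) v"
    using hermitian_least_eigenvector[of S] by (auto simp: S_def adj_mult)
  have n_less: "n i < r $ i" if "l i > 1" for i
    using that pos[of i] by (simp add: n_eq mult_pos_neg)
  have m_le: "m \<le> 1"
  proof (rule ccontr)
    assume "\<not> m \<le> 1"
    then have "m > 1" by simp
    have "l i > 1" for i
    proof (cases "column i F = 0")
      case True
      then show ?thesis using pos[of i] by (simp add: l_def n_def)
    next
      case False
      then have "m \<le> l i"
        using ray[of "column i F"] by (simp add: eig power2_norm_eq_inner)
      with \<open>m > 1\<close> show ?thesis by simp
    qed
    then have "(\<Sum>i\<in>UNIV. n i) < (\<Sum>i\<in>UNIV. r $ i)"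
      by (intro sum_strict_mono n_less) auto
    moreover have "(\<Sum>a\<in>(UNIV :: 'd set). m) \<le> inner S (mat 1)"
      unfolding inner_one_eq_sum_axis using ray[of "axis _ 1"] by (intro sum_mono) (simp add: norm_axis_one)
    moreover have "real CARD('d) < CARD('d) * m"
      using \<open>m > 1\<close> by simp
    ultimately show False
      by (simp add: trace sum_r)
  qed
  \<comment> \<open>If \<open>l i > 1\<close>, the column is too short, so \<open>n i < r $ i \<le> 1\<close>, but also \<open>n i = l i > 1\<close>.\<close>
  have l_le: "l i \<le> 1" for i
  proof (rule ccontr)
    assume "\<not> l i \<le> 1"
    then have "l i > 1" by simp
    with m_le have "n i = l i"
      using column_norm_eq_eigenvalue_of_local_min[OF min eig[unfolded S_def] l_eq e(1) e(2)[unfolded S_def]]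
      by (simp add: n_def)
    with n_less[OF \<open>l i > 1\<close>] le_one[of i] \<open>l i > 1\<close> show False by simp
  qed
  \<comment> \<open>With all \<open>l i \<le> 1\<close>, \<open>S\<^sup>2\<close> has at most the trace of \<open>S\<close>, while the columns are too long on
    the whole; both can only hold with equality.\<close>
  have n_ge: "r $ i \<le> n i" for i
    using l_le[of i] by (simp add: n_eq)
  have "inner S S = inner (S ** F) F"
    using inner_mult_adj_right[of F "adj F" S] by (simp add: S_def inner_commute)
  also have "\<dots> = (\<Sum>i\<in>UNIV. l i * n i)"
    unfolding n_def by (rule inner_matrix_eigencolumns[OF eig])
  also have "\<dots> \<le> (\<Sum>i\<in>UNIV. n i)"
    using mult_right_mono[OF l_le, of "n _"] by (intro sum_mono) (simp add: n_def)
  finally have "inner S S \<le> (\<Sum>i\<in>UNIV. n i)" .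
  then have le: "(norm (S - mat 1))\<^sup>2 \<le> CARD('d) - (\<Sum>i\<in>UNIV. n i)"
    using norm_one_matrix[where 'd = 'd]
    by (simp add: power2_norm_eq_inner inner_diff_left inner_diff_right trace
        inner_commute[of "mat 1" S])
  have sum_le: "(\<Sum>i\<in>UNIV. r $ i) \<le> (\<Sum>i\<in>UNIV. n i)"
    by (intro sum_mono n_ge)
  have "(norm (S - mat 1))\<^sup>2 = 0"
    using le sum_le sum_r zero_le_power2[of "norm (S - mat 1)"] by linarith
  moreover have "n i = r $ i" for i
  proof -
    have "(\<Sum>i\<in>UNIV. n i - r $ i) = 0"
      using le sum_le sum_r zero_le_power2[of "norm (S - mat 1)"] unfolding sum_subtractf by linarith
    then show ?thesis
      using n_ge by (simp add: sum_nonneg_eq_0_iff)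
  qed
  ultimately show ?thesis
    using pos by (simp add: total_frame_energy_def S_def n_def less_imp_neq[symmetric] less_imp_neq)
qed

end

interpretation real_conj: conjugation "id :: real \<Rightarrow> real"
  by unfold_locales simp_all

interpretation complex_conj: conjugation cnj
  by unfold_locales (simp_all add: inner_complex_def algebra_simps complex_eq_iff)

lemma total_frame_energy_nonneg: "0 \<le> total_frame_energy c r F"
  by (simp add: total_frame_energy_def sum_nonneg)

theorem corollary2p9:
  fixes r :: "real ^ 'n"
  assumes "CARD('d :: finite) \<le> CARD('n)"
    and "\<forall>i. r $ i \<in> \<rat> \<and> r $ i > 0"
    and "admissible CARD('d) r"
  shows "(\<forall>F :: real ^ 'n ^ 'd.
            is_local_min (total_frame_energy id r) F \<longrightarrow>
            is_global_min (total_frame_energy id r) F)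
       \<and> (\<forall>F :: complex ^ 'n ^ 'd.
            is_local_min (total_frame_energy cnj r) F \<longrightarrow>
            is_global_min (total_frame_energy cnj r) F)"
proof -
  have pos: "\<And>i. r $ i > 0" and sum_r: "(\<Sum>i\<in>UNIV. r $ i) = CARD('d)"
    using assms(3) by (simp_all add: admissible_def)
  note zero = pos admissible_weight_le_one[OF assms(3)] sum_r
  show ?thesis
    unfolding is_global_min_def
    using real_conj.frame_energy_zero_of_local_min[OF _ zero]
      complex_conj.frame_energy_zero_of_local_min[OF _ zero]
    by (simp add: total_frame_energy_nonneg)
qed

end
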